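(* Let $n\ge 1$. Let $\mathcal{Y}_1$ be the (unital) subalgebra of $\mathrm{DTL}(\mathrm{B}_n)$ generated by $\{e_i\}_{i=1}^{n-1}$ and let $\mathcal{Y}_2$ be the (unital) subalgebra generated by $\{\hat e_i\}_{i=0}^{n-1}$. Then $$\mathrm{DTL}(\mathrm{B}_n)=\mathcal{Y}_1+\mathcal{Y}_2 ,$$ and $\mathrm{DTL}(\mathrm{B}_n)$ can be spanned over $\mathbb{Z}[\delta^{\pm1}]$ by $C_n+C_{n+1}-1$ elements, where $C_k=\frac{1}{k+1}\binom{2k}{k}$ denotes the $k$-th Catalan number.
   Context: All algebras are associative and unital over $\mathbb{Z}[\delta^{\pm 1}]$, where $\delta$ is an invertible indeterminate. $\mathrm{DTL}(\mathrm{B}_n)$ (the Dieck-Temperley-Lieb algebra of type $\mathrm{B}_n$) is the $\mathbb{Z}[\delta^{\pm1}]$-algebra generated by $e_0,e_1,\dots,e_{n-1}$ subject to: $e_0^2=\delta^2 e_0$; $e_i^2=\delta e_i$ for $1\le i\le n-1$; $e_ie_j=e_je_i$ if $|i-j|>1$; $e_ie_je_i=e_i$ if $i,j\ge 1$ and $|i-j|=1$; and $e_0e_1e_0=\delta e_0$. The elements $\hat e_i$ are defined by $\hat e_0=e_0$, $\hat e_1=e_1e_0e_1$, and $\hat e_{i+1}=e_{i+1}\hat e_ie_{i+1}$ for $1\le i\le n-2$. *)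

theory Defs
  imports
    "HOL-Library.Poly_Mapping"
    "HOL-Algebra.Module"
    "HOL-Algebra.QuotRing"
    "HOL-Algebra.Subrings"
begin

section \<open>The ground ring\<close>

text \<open>Laurent polynomials over the integers are the group ring of the additive group of integers:
  \<^term>\<open>Poly_Mapping.single k a\<close> stands for $a \delta^k$, and the product on
  \<^typ>\<open>int \<Rightarrow>\<^sub>0 int\<close> is convolution.\<close>

type_synonym laurent = "int \<Rightarrow>\<^sub>0 int"

definition \<delta> :: laurent where
  "\<delta> = Poly_Mapping.single 1 1"

lemma delta_invertible: "\<delta> * Poly_Mapping.single (- 1) 1 = 1"
  by (simp add: \<delta>_def mult_single)

definition laurent_ring :: "laurent ring" where
  "laurent_ring = \<lparr>carrier = UNIV, mult = (*), one = 1, zero = 0, add = (+)\<rparr>"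

section \<open>Free algebras\<close>

datatype word = Word (letters: "nat list")

instantiation word :: monoid_add
begin

definition zero_word :: word where
  "0 = Word []"

definition plus_word :: "word \<Rightarrow> word \<Rightarrow> word" where
  "v + w = Word (letters v @ letters w)"

instance
  by standard (simp_all add: zero_word_def plus_word_def)

end

text \<open>The instance writes concatenation of words additively, so the convolution product makes
  \<^typ>\<open>word \<Rightarrow>\<^sub>0 laurent\<close> the free unital algebra on the letters
  $X_0, X_1, X_2, \dots$.\<close>

type_synonym freealg = "word \<Rightarrow>\<^sub>0 laurent"

definition var :: "nat \<Rightarrow> freealg" where
  "var i = Poly_Mapping.single (Word [i]) 1"

definition scalar :: "laurent \<Rightarrow> freealg" where
  "scalar c = Poly_Mapping.single 0 c"

text \<open>The free algebra on $X_0, \dots, X_{n-1}$.\<close>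

definition free_algebra :: "nat \<Rightarrow> (laurent, freealg) module" where
  "free_algebra n =
    \<lparr>carrier = {f. \<forall>w \<in> Poly_Mapping.keys f. set (letters w) \<subseteq> {..<n}},
     mult = (*), one = 1, zero = 0, add = (+), smult = (\<lambda>c f. scalar c * f)\<rparr>"

lemma cring_laurent_ring: "cring laurent_ring"
proof -
  have "\<exists>y. y + x = 0" for x :: laurent
    by (metis add.left_inverse)
  then show ?thesis
    by (intro cringI abelian_groupI comm_monoidI)
      (auto simp: laurent_ring_def algebra_simps)
qed

lemma scalar_mult_single:
  "scalar c * Poly_Mapping.single w a = Poly_Mapping.single w (c * a)"
  "Poly_Mapping.single w a * scalar c = Poly_Mapping.single w (c * a)"
  by (simp_all add: scalar_def mult_single mult.commute)

lemma scalar_central: "scalar c * f = f * scalar c"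
proof (induction f rule: update_induct)
  case (update f w a)
  have "Poly_Mapping.update w a f = Poly_Mapping.single w a + f"
    using update(1) by (intro poly_mapping_eqI)
      (auto simp: lookup_update lookup_add lookup_single in_keys_iff when_def)
  then show ?case
    using update(3) by (simp add: distrib_left distrib_right scalar_mult_single)
qed simp

lemma scalar_hom: "scalar (c + d) = scalar c + scalar d" "scalar (c * d) = scalar c * scalar d"
  "scalar 1 = 1"
  by (simp_all add: scalar_def mult_single single_add)

lemma keys_scalar_mult: "Poly_Mapping.keys (scalar c * f) \<subseteq> Poly_Mapping.keys f"
  using keys_mult[of "scalar c" f] by (auto simp: scalar_def split: if_splits)

lemma free_algebra_closed:
  assumes "f \<in> carrier (free_algebra n)" "g \<in> carrier (free_algebra n)"
  shows "f + g \<in> carrier (free_algebra n)" "f - g \<in> carrier (free_algebra n)"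
    "- f \<in> carrier (free_algebra n)"
    "f * g \<in> carrier (free_algebra n)" "scalar c * f \<in> carrier (free_algebra n)"
proof -
  show "f + g \<in> carrier (free_algebra n)" "f - g \<in> carrier (free_algebra n)"
    using assms Poly_Mapping.keys_add[of f g] keys_diff[of f g]
    by (auto simp: free_algebra_def)
  show "- f \<in> carrier (free_algebra n)"
    using assms by (simp add: free_algebra_def)
  show "f * g \<in> carrier (free_algebra n)"
    using assms keys_mult[of f g] by (fastforce simp: free_algebra_def plus_word_def)
  show "scalar c * f \<in> carrier (free_algebra n)"
    using assms keys_scalar_mult[of c f] by (auto simp: free_algebra_def)
qed

lemma var_closed: "i < n \<Longrightarrow> var i \<in> carrier (free_algebra n)"
  by (simp add: var_def free_algebra_def)

lemma module_free_algebra: "module laurent_ring (free_algebra n)"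
  and ring_free_algebra: "ring (free_algebra n)"
proof -
  have zero: "0 \<in> carrier (free_algebra n)" and one: "1 \<in> carrier (free_algebra n)"
    by (simp_all add: free_algebra_def zero_word_def)
  have neg: "\<exists>y\<in>carrier (free_algebra n). y + x = 0"
    if "x \<in> carrier (free_algebra n)" for x
    using free_algebra_closed(3)[OF that that] by (metis add.left_inverse)
  have simps: "mult (free_algebra n) = (*)" "add (free_algebra n) = (+)"
    "zero (free_algebra n) = 0" "one (free_algebra n) = 1"
    "smult (free_algebra n) = (\<lambda>c f. scalar c * f)"
    by (simp_all add: free_algebra_def)
  have ab: "abelian_group (free_algebra n)"
    by (rule abelian_groupI)
      (simp_all only: simps free_algebra_closed zero neg add.assoc add_0_left, simp add: add.commute)
  show "ring (free_algebra n)"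
    by (intro ringI ab monoidI)
      (simp_all only: simps free_algebra_closed one mult.assoc mult_1_left mult_1_right
        distrib_left distrib_right)
  show "module laurent_ring (free_algebra n)"
    by (rule moduleI[OF cring_laurent_ring ab])
      (simp_all only: simps free_algebra_closed laurent_ring_def ring.simps partial_object.simps
        monoid.simps scalar_hom mult.assoc mult_1_left distrib_left distrib_right)
qed

section \<open>Quotients, subalgebras and spans\<close>

text \<open>Scalar multiplication on cosets follows the pattern of \<^const>\<open>rcoset_mult\<close>; for a
  two-sided ideal all members of the union are the same coset (lemma \<open>smult_DTL\<close> below).\<close>

definition quotient_algebra ::
    "('r, 'a) module \<Rightarrow> 'a set \<Rightarrow> ('r, 'a set) module" where
  "quotient_algebra A I =
    ring.extend (A Quot I)
      (module.fields (\<lambda>c C. \<Union>x\<in>C. I +>\<^bsub>A\<^esub> (c \<odot>\<^bsub>A\<^esub> x)))"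

definition unital_subalgebra ::
    "('r, 'm) ring_scheme \<Rightarrow> ('r, 'a) module \<Rightarrow> 'a set \<Rightarrow> bool" where
  "unital_subalgebra R A H \<longleftrightarrow> subring H A \<and> submodule H R A"

definition subalgebra_generated ::
    "('r, 'm) ring_scheme \<Rightarrow> ('r, 'a) module \<Rightarrow> 'a set \<Rightarrow> 'a set" where
  "subalgebra_generated R A S = unital_subalgebra R A hull S"

definition module_span ::
    "('r, 'm) ring_scheme \<Rightarrow> ('r, 'a) module \<Rightarrow> 'a set \<Rightarrow> 'a set" where
  "module_span R M S = (\<lambda>H. submodule H R M) hull S"

section \<open>The Dieck-Temperley-Lieb algebra of type B\<close>

text \<open>A relation $u = v$ is represented by the element $u - v$.\<close>

inductive_set dtl_relations :: "nat \<Rightarrow> freealg set" for n :: nat where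
  square_0: "0 < n \<Longrightarrow> var 0 * var 0 - scalar (\<delta>\<^sup>2) * var 0 \<in> dtl_relations n"
| square: "\<lbrakk>1 \<le> i; i < n\<rbrakk> \<Longrightarrow> var i * var i - scalar \<delta> * var i \<in> dtl_relations n"
| commute: "\<lbrakk>i < n; j < n; \<bar>int i - int j\<bar> > 1\<rbrakk>
    \<Longrightarrow> var i * var j - var j * var i \<in> dtl_relations n"
| cubic: "\<lbrakk>1 \<le> i; i < n; 1 \<le> j; j < n; \<bar>int i - int j\<bar> = 1\<rbrakk>
    \<Longrightarrow> var i * var j * var i - var i \<in> dtl_relations n"
| cubic_0: "1 < n \<Longrightarrow> var 0 * var 1 * var 0 - scalar \<delta> * var 0 \<in> dtl_relations n"

lemma dtl_relations_subset: "dtl_relations n \<subseteq> carrier (free_algebra n)"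
  by (auto elim!: dtl_relations.cases intro!: free_algebra_closed var_closed)

definition dtl_ideal :: "nat \<Rightarrow> freealg set" where
  "dtl_ideal n = Idl\<^bsub>free_algebra n\<^esub> (dtl_relations n)"

definition DTL :: "nat \<Rightarrow> (laurent, freealg set) module" where
  "DTL n = quotient_algebra (free_algebra n) (dtl_ideal n)"

definition dtl_e :: "nat \<Rightarrow> nat \<Rightarrow> freealg set" where
  "dtl_e n i = dtl_ideal n +>\<^bsub>free_algebra n\<^esub> var i"

fun dtl_e_hat :: "nat \<Rightarrow> nat \<Rightarrow> freealg set" where
  "dtl_e_hat n 0 = dtl_e n 0"
| "dtl_e_hat n (Suc 0) = dtl_e n 1 \<otimes>\<^bsub>DTL n\<^esub> dtl_e n 0 \<otimes>\<^bsub>DTL n\<^esub> dtl_e n 1"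
| "dtl_e_hat n (Suc (Suc i)) =
    dtl_e n (Suc (Suc i)) \<otimes>\<^bsub>DTL n\<^esub> dtl_e_hat n (Suc i) \<otimes>\<^bsub>DTL n\<^esub> dtl_e n (Suc (Suc i))"

definition catalan :: "nat \<Rightarrow> nat" where
  "catalan k = (2 * k choose k) div (k + 1)"

lemma catalan_eq: "real (catalan k) = real (2 * k choose k) / real (k + 1)"
proof -
  have "Suc k * (2 * k choose Suc k) = k * (2 * k choose k)"
    using binomial_absorb_comp[of "2 * k" k] binomial_absorption[of k "2 * k"]
    by (simp only: mult_2 add_diff_cancel_right')
  then have "(k + 1) * ((2 * k choose k) - (2 * k choose Suc k)) = (2 * k choose k)"
    by (simp add: diff_mult_distrib2)
  then have "(k + 1) dvd (2 * k choose k)"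
    by (metis dvd_triv_left)
  then show ?thesis
    by (simp add: catalan_def real_of_nat_div)
qed

lemma ideal_dtl_ideal: "ideal (dtl_ideal n) (free_algebra n)"
  unfolding dtl_ideal_def
  by (rule ring.genideal_ideal[OF ring_free_algebra dtl_relations_subset])

lemma smult_DTL:
  assumes "f \<in> carrier (free_algebra n)"
  shows "c \<odot>\<^bsub>DTL n\<^esub> (dtl_ideal n +>\<^bsub>free_algebra n\<^esub> f)
    = dtl_ideal n +>\<^bsub>free_algebra n\<^esub> (scalar c * f)"
proof -
  interpret I: ideal "dtl_ideal n" "free_algebra n" by (rule ideal_dtl_ideal)
  let ?A = "free_algebra n" and ?I = "dtl_ideal n"
  have A: "add ?A = (+)" "mult ?A = (*)" "smult ?A = (\<lambda>c f. scalar c * f)"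
    by (simp_all add: free_algebra_def)
  have sc: "scalar c \<in> carrier ?A"
    by (simp add: scalar_def free_algebra_def zero_word_def)
  have "?I +>\<^bsub>?A\<^esub> (scalar c * x) = ?I +>\<^bsub>?A\<^esub> (scalar c * f)"
    if x: "x \<in> ?I +>\<^bsub>?A\<^esub> f" for x
  proof -
    obtain h where h: "h \<in> ?I" "x = h + f"
      using x by (auto simp: a_r_coset_def' A)
    have "scalar c * h \<in> ?I"
      using I.I_l_closed[OF h(1) sc] by (simp add: A)
    then have "scalar c * x \<in> ?I +>\<^bsub>?A\<^esub> (scalar c * f)"
      by (auto simp: a_r_coset_def' A h(2) distrib_left)
    then show ?thesis
      using I.a_repr_independence'[of "scalar c * x" "scalar c * f"]
        free_algebra_closed(5)[OF assms assms] by simp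
  qed
  moreover have "f \<in> ?I +>\<^bsub>?A\<^esub> f"
    using I.a_rcos_self[OF assms] .
  ultimately have "(\<Union>x \<in> ?I +>\<^bsub>?A\<^esub> f. ?I +>\<^bsub>?A\<^esub> (scalar c * x))
      = ?I +>\<^bsub>?A\<^esub> (scalar c * f)"
    by blast
  then show ?thesis
    by (simp add: DTL_def quotient_algebra_def ring.defs module.defs A)
qed

lemma DTL_ops:
  "carrier (DTL n) = carrier (free_algebra n Quot dtl_ideal n)"
  "mult (DTL n) = mult (free_algebra n Quot dtl_ideal n)"
  "one (DTL n) = one (free_algebra n Quot dtl_ideal n)"
  "zero (DTL n) = zero (free_algebra n Quot dtl_ideal n)"
  "add (DTL n) = add (free_algebra n Quot dtl_ideal n)"
  by (simp_all add: DTL_def quotient_algebra_def ring.defs module.defs)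

lemma ring_DTL: "ring (DTL n)"
  and module_DTL: "module laurent_ring (DTL n)"
proof -
  interpret I: ideal "dtl_ideal n" "free_algebra n" by (rule ideal_dtl_ideal)
  let ?A = "free_algebra n" and ?q = "\<lambda>f. dtl_ideal n +>\<^bsub>free_algebra n\<^esub> f"
  interpret Q: ring "?A Quot dtl_ideal n" by (rule I.quotient_is_ring)
  have carr: "carrier (DTL n) = ?q ` carrier ?A"
    by (auto simp: DTL_ops FactRing_simps)
  have add: "?q f \<oplus>\<^bsub>DTL n\<^esub> ?q g = ?q (f + g)"
    if "f \<in> carrier ?A" "g \<in> carrier ?A" for f g
    using I.a_rcos_sum[OF that]
    by (simp_all add: DTL_ops FactRing_def) (simp_all add: free_algebra_def)
  show ring: "ring (DTL n)"
    by (intro ringI abelian_groupI monoidI; unfold DTL_ops)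
      (simp_all only: Q.a_closed Q.zero_closed Q.a_assoc Q.l_zero Q.add.l_inv_ex Q.m_closed
        Q.one_closed Q.m_assoc Q.l_one Q.r_one Q.l_distr Q.r_distr, rule Q.a_comm)
  show "module laurent_ring (DTL n)"
  proof (rule moduleI[OF cring_laurent_ring ring.is_abelian_group[OF ring]])
  qed (auto simp: carr add smult_DTL free_algebra_closed laurent_ring_def scalar_hom
    distrib_left distrib_right mult.assoc)
qed

end

theory Submission
  imports Defs
begin

text \<open>All relations are of the form word = power of \<open>\<delta>\<close> times word, so up to units one computes with
  words. With \<open>h\<^sub>i\<close> for the hatted elements, induction along their recursive definition gives, up to
  units, \<open>e\<^sub>i h\<^sub>j = h\<^sub>i h\<^sub>j\<close> and \<open>h\<^sub>j e\<^sub>i = h\<^sub>j h\<^sub>i\<close> for all \<open>i, j\<close>. Since \<open>e\<^sub>0 = h\<^sub>0\<close>, a word that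
  contains \<open>e\<^sub>0\<close> does not change when all its letters get a hat: it lies in the second subalgebra,
  and every other word lies in the first one. The hatted elements satisfy the Temperley-Lieb relations
  as well, so both kinds of words reduce to Jones normal forms, which are counted by Catalan numbers;
  the empty word is counted twice.\<close>

section \<open>Normal forms for the Temperley-Lieb relations\<close>

text \<open>The relations are imposed on functions, where no powers of \<open>\<delta>\<close>
  appear. One normal form argument then serves both the hatted letters and the unhatted letters of
  positive index.\<close>

locale temperley_lieb_action =
  fixes m :: nat and x :: "nat \<Rightarrow> 'a \<Rightarrow> 'a"
  assumes idem: "i < m \<Longrightarrow> x i (x i s) = x i s"
    and braid: "\<lbrakk>i < m; j < m; j = Suc i \<or> i
        = Suc j\<rbrakk> \<Longrightarrow> x i (x j (x i s)) = x i s"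
    and far: "\<lbrakk>i < m; j < m; Suc i < j\<rbrakk> \<Longrightarrow> x i (x j s) = x j (x i s)"
begin

lemma far_letter:
  assumes "\<forall>i\<in>set u. i < m \<and> (Suc i < k \<or> Suc k < i)" "k < m"
  shows "x k (foldr x u s) = foldr x u (x k s)"
  using assms
proof (induction u)
  case (Cons i u)
  then have "x k (x i (foldr x u s)) = x i (x k (foldr x u s))"
    using far[of i k "foldr x u s"] far[of k i "foldr x u s"] by auto
  moreover have "x k (foldr x u s) = foldr x u (x k s)"
    by (rule Cons.IH) (use Cons.prems in auto)
  ultimately show ?case by (simp only: foldr_Cons o_apply)
qed simp

lemma far_words:
  assumes "\<forall>i\<in>set u. \<forall>k\<in>set v. i < m \<and> k < m \<and> (Suc i < k \<or> Suc k < i)"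
  shows "foldr x v (foldr x u s) = foldr x u (foldr x v s)"
  using assms
proof (induction v)
  case step: (Cons a v)
  have "x a (foldr x u (foldr x v s)) = foldr x u (x a (foldr x v s))"
  \<comment> \<open>For empty \<open>u\<close> the hypothesis is vacuous and gives no bound on
    \<open>a\<close>, but then both sides coincide.\<close>
  proof (cases u)
    case (Cons b u')
    then show ?thesis
      using step.prems by (intro far_letter) auto
  qed simp
  moreover have "foldr x v (foldr x u s) = foldr x u (foldr x v s)"
    by (rule step.IH) (use step.prems in simp)
  ultimately show ?case by (simp only: foldr_Cons o_apply)
qed simp

end

section \<open>Descending runs and Jones normal forms\<close>

definition down :: "nat \<Rightarrow> nat \<Rightarrow> nat list" where
  "down m j = rev [j..<m]"

lemma set_down [simp]: "set (down m j) = {j..<m}"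
  by (simp add: down_def)

lemma down_self [simp]: "down j j = []"
  by (simp add: down_def)

lemma down_append: "\<lbrakk>j \<le> k; k \<le> m\<rbrakk> \<Longrightarrow> down m k @ down k j = down m j"
  using upt_add_eq_append[of j k "m - k"] by (simp add: down_def flip: rev_append)

lemma down_Suc_self: "down (Suc j) j = [j]"
  by (simp add: down_def)

lemma down_snoc: "j < m \<Longrightarrow> down m (Suc j) @ [j] = down m j"
  using down_append[of j "Suc j" m] by (simp add: down_Suc_self)

text \<open>Jones normal forms are products of descending runs whose first and last letters both
  increase strictly from one run to the next. The second argument of \<open>jones\<close> is a strict
  upper bound for the last letters of the runs.\<close>

fun jones :: "nat \<Rightarrow> nat \<Rightarrow> nat list set" where
  "jones 0 j = {[]}"
| "jones (Suc m) j = jones m (min j m) \<union>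
    (\<Union>k\<in>{..<min j (Suc m)}. (\<lambda>w. w @ down (Suc m) k) ` jones m k)"

lemma jones_letters: "w \<in> jones m j \<Longrightarrow> set w \<subseteq> {..<m}"
proof (induction m arbitrary: w j)
  case (Suc m)
  then consider "w \<in> jones m (min j m)"
    | k u where "w = u @ down (Suc m) k" "u \<in> jones m k"
    by auto
  then show ?case
    by cases (use Suc.IH in fastforce)+
qed simp

lemma Nil_in_jones: "[] \<in> jones m j"
  by (induction m arbitrary: j) auto

lemma jones_Suc: "jones (Suc m) (Suc m) =
    jones m m \<union> {w @ down (Suc m) k | w k. k \<le> m \<and> w \<in> jones m k}"
proof -
  have "(\<Union>k\<in>{..m}. (\<lambda>w. w @ down (Suc m) k) ` jones m k)
      = {w @ down (Suc m) k | w k. k \<le> m \<and> w \<in> jones m k}"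
    by blast
  moreover have "min (Suc m) m = m" "{..<min (Suc m) (Suc m)} = {..m}"
    by auto
  ultimately show ?thesis
    by (simp only: jones.simps)
qed

text \<open>Last letters of runs increase, so only the final run can violate the bound
  \<open>k\<close>. This final run is the one that \<open>run_run\<close> merges with a run ending
  in \<open>k\<close>.\<close>

lemma jones_last_run:
  assumes "w \<in> jones m j" "w \<notin> jones m k"
  obtains v i l where "w = v @ down (Suc i) l" "k \<le> l" "l \<le> i" "i < m" "set v \<subseteq> {..<m}"
  using assms
proof (induction m arbitrary: w j k thesis)
  case (Suc m)
  show ?case
  proof (cases "w \<in> jones m (min j m)")
    case True
    moreover have "w \<notin> jones m (min k m)"
      using Suc.prems(3) by simp
    ultimately obtain v i l where *: "w = v @ down (Suc i) l" "min k m \<le> l" "l \<le> i" "i < m"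
      "set v \<subseteq> {..<m}"
      using Suc.IH by blast
    \<comment> \<open>Since \<open>l < m\<close>, the minimum can only be \<open>k\<close>.\<close>
    then have "k \<le> l" by auto
    then show ?thesis using * by (intro Suc.prems(1)[of v i l]) auto
  next
    case False
    then obtain l v where *: "l < min j (Suc m)" "w = v @ down (Suc m) l" "v \<in> jones m l"
      using Suc.prems(2) by auto
    then have "\<not> l < min k (Suc m)"
      using Suc.prems(3) by auto
    then show ?thesis
      using * jones_letters[OF *(3)] by (intro Suc.prems(1)[of v m l]) auto
  qed
qed simp

declare jones.simps(2) [simp del]

section \<open>Rewriting arbitrary words to Jones normal form\<close>

context temperley_lieb_action
begin

text \<open>The letter \<open>k\<close> moves left until it meets \<open>k\<close> and
  \<open>k - 1\<close>. The cubic relation deletes \<open>k - 1\<close>, which cuts the run into two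
  pieces, and these commute.\<close>

lemma run_letter:
  assumes "j < k" "k < n" "n \<le> m"
  shows "foldr x (down n j) (x k s) = foldr x (down (k - 1) j) (foldr x (down n k) s)"
proof -
  obtain l where k: "k = Suc l" "j \<le> l"
    using assms(1) by (cases k) auto
  have dn: "down n j = down n (Suc k) @ [k, l] @ down l j"
    using assms k down_append[of j l k] down_append[of j k n, symmetric] down_snoc[of k n, symmetric]
    by (simp add: down_Suc_self)
  have "foldr x (down l j) (x k s) = x k (foldr x (down l j) s)"
    using assms k by (intro far_letter[symmetric]) auto
  then have "foldr x (down n j) (x k s) = foldr x (down n (Suc k)) (x k (x l (x k (foldr x (down l j) s))))"
    by (simp add: dn)
  also have "\<dots> = foldr x (down n (Suc k)) (x k (foldr x (down l j) s))"
    using assms k by (simp add: braid)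
  also have "\<dots> = foldr x (down n k) (foldr x (down l j) s)"
    using assms down_snoc[of k n, symmetric] by simp
  also have "\<dots> = foldr x (down l j) (foldr x (down n k) s)"
    using assms k by (intro far_words) auto
  finally show ?thesis using k by simp
qed

text \<open>The last letter \<open>l\<close> of the first run moves right to the letters
  \<open>Suc l\<close> and \<open>l\<close> of the second, where the cubic relation deletes
  \<open>Suc l\<close>. The lower part of the second run then extends the first, and what remains
  behind it ends in \<open>Suc (Suc l)\<close>, beyond \<open>k\<close>.\<close>

lemma run_run:
  assumes "k \<le> l" "l < i" "i < n" "n \<le> m"
  shows "foldr x (down i l) (foldr x (down n k) s)
    = foldr x (down i k) (foldr x (down n (Suc (Suc l))) s)"
proof -
  let ?d = "down n (Suc (Suc l))" and ?t = "foldr x (down l k) s"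
  have "down n k = ?d @ [Suc l] @ [l] @ down l k"
    using assms by (simp only: down_snoc down_append append_assoc[symmetric])
  then have "foldr x (down i l) (foldr x (down n k) s)
      = foldr x (down i (Suc l) @ [l]) (foldr x ?d (x (Suc l) (x l ?t)))"
    using assms down_snoc[of l i] by simp
  also have "\<dots> = foldr x (down i (Suc l)) (foldr x ?d (x l (x (Suc l) (x l ?t))))"
    using assms far_letter[of ?d l] by simp
  also have "x l (x (Suc l) (x l ?t)) = x l ?t"
    using assms by (intro braid) auto
  also have "x l ?t = foldr x (down (Suc l) k) s"
    using assms down_append[of k l "Suc l", symmetric] by (simp add: down_Suc_self)
  also have "foldr x ?d (foldr x (down (Suc l) k) s) = foldr x (down (Suc l) k) (foldr x ?d s)"
    using assms by (intro far_words) auto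
  also have "foldr x (down i (Suc l)) \<dots> = foldr x (down i (Suc l) @ down (Suc l) k) (foldr x ?d s)"
    by simp
  also have "down i (Suc l) @ down (Suc l) k = down i k"
    using assms by (intro down_append) auto
  finally show ?thesis .
qed

text \<open>The induction is on the length of the appended run. If the normal form of
  \<open>w\<close> does not admit this run, \<open>run_run\<close> replaces it by a shorter one, and
  everything before that still uses only letters below \<open>n\<close>.\<close>

lemma jones_run:
  assumes jones: "\<And>w. set w \<subseteq> {..<n} \<Longrightarrow> \<exists>v\<in>jones n n. foldr x w = foldr x v"
    and "n < m" "k \<le> Suc n" "set w \<subseteq> {..<n}"
  shows "\<exists>v\<in>jones (Suc n) (Suc n). foldr x (w @ down (Suc n) k) = foldr x v"
  using assms(3,4)
proof (induction "Suc n - k" arbitrary: k w rule: less_induct)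
  case less
  obtain v where v: "v \<in> jones n n" "foldr x w = foldr x v"
    using jones less.prems by blast
  consider "k = Suc n" | "k \<le> n" "v \<in> jones n k" | "k \<le> n" "v \<notin> jones n k"
    using less.prems by linarith
  then show ?case
  proof cases
    case 1
    then have "foldr x (w @ down (Suc n) k) = foldr x v"
      using v(2) by simp
    then show ?thesis using v(1) unfolding jones_Suc by blast
  next
    case 2
    then have "v @ down (Suc n) k \<in> jones (Suc n) (Suc n)"
      unfolding jones_Suc by blast
    moreover have "foldr x (w @ down (Suc n) k) = foldr x (v @ down (Suc n) k)"
      using v(2) by (simp add: fun_eq_iff)
    ultimately show ?thesis by metis
  next
    case 3
    obtain u i l where u: "v = u @ down (Suc i) l" "k \<le> l" "l \<le> i" "i < n" "set u \<subseteq> {..<n}"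
      using jones_last_run[OF v(1) 3(2)] by blast
    have "foldr x (w @ down (Suc n) k) = foldr x ((u @ down (Suc i) k) @ down (Suc n) (Suc (Suc l)))"
      (is "_ = foldr x ?w")
    proof
      fix s
      have "foldr x (w @ down (Suc n) k) s
          = foldr x u (foldr x (down (Suc i) l) (foldr x (down (Suc n) k) s))"
        unfolding foldr_append v(2) u(1) ..
      also have "\<dots> = foldr x ?w s"
        using run_run[of k l "Suc i" "Suc n" s] u \<open>n < m\<close> by simp
      finally show "foldr x (w @ down (Suc n) k) s = foldr x ?w s" .
    qed
    moreover have "\<exists>v\<in>jones (Suc n) (Suc n). foldr x ?w = foldr x v"
      using u less.prems by (intro less.hyps) auto
    ultimately show ?thesis by simp
  qed
qed

text \<open>The products of a word in the letters below \<open>n\<close> and one run starting at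
  \<open>n\<close>, possibly empty, are closed up to equality under appending a letter. The outer
  induction normalizes the lower word, and \<open>jones_run\<close> fits the run to it.\<close>

theorem jones_normal_form:
  assumes "n \<le> m" "set w \<subseteq> {..<n}"
  shows "\<exists>v\<in>jones n n. foldr x w = foldr x v"
  using assms
proof (induction n arbitrary: w)
  case (Suc n)
  have IH: "\<exists>v\<in>jones n n. foldr x w = foldr x v" if "set w \<subseteq> {..<n}" for w
    using Suc.prems(1) that by (intro Suc.IH) simp_all
  have run: "\<exists>v\<in>jones (Suc n) (Suc n). foldr x (w @ down (Suc n) k) = foldr x v"
    if "set w \<subseteq> {..<n}" "k \<le> Suc n" for w k
    using Suc.prems(1) that by (intro jones_run IH) simp_all
  show ?case
    using Suc.prems(2)
  proof (induction w rule: rev_induct)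
    case Nil
    then show ?case using Nil_in_jones by blast
  next
    case (snoc c w)
    then have c: "c \<le> n" by simp
    obtain v where v: "v \<in> jones (Suc n) (Suc n)" "foldr x w = foldr x v"
      using snoc by auto
    then have w: "foldr x (w @ [c]) = foldr x (v @ [c])" by (simp add: fun_eq_iff)
    have "\<exists>v'\<in>jones (Suc n) (Suc n). foldr x (v @ [c]) = foldr x v'"
    proof (cases "v \<in> jones n n")
      case True
      \<comment> \<open>For \<open>c < n\<close> the appended run is empty, as
        \<open>down (Suc n) (Suc n) = []\<close>.\<close>
      have "v @ [c] = (if c = n then v @ down (Suc n) n else (v @ [c]) @ down (Suc n) (Suc n))"
        by (simp add: down_Suc_self)
      then show ?thesis
        using run[of v n] run[of "v @ [c]" "Suc n"] jones_letters[OF True] c by (auto split: if_splits)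
    next
      case False
      then obtain j u where j: "j \<le> n" "u \<in> jones n j" "v = u @ down (Suc n) j"
        using v(1) unfolding jones_Suc by blast
      have u: "set u \<subseteq> {..<n}" using jones_letters[OF j(2)] .
      \<comment> \<open>The letter \<open>c\<close> repeats the end of the run, cuts the run,
        prolongs it downwards, or commutes with all of it.\<close>
      consider "c = j" | "j < c" | "Suc c = j" | "Suc c < j" by linarith
      then show ?thesis
      proof cases
        case 1
        have "foldr x (v @ [c]) s = foldr x v s" for s
          using down_snoc[of j "Suc n", symmetric] 1 j Suc.prems(1) by (simp add: idem)
        then have "foldr x (v @ [c]) = foldr x v" ..
        then show ?thesis using v(1) by metis
      next
        case 2
        have "foldr x (v @ [c]) = foldr x ((u @ down (c - 1) j) @ down (Suc n) c)"
          using run_letter[OF 2, of "Suc n"] c j Suc.prems(1) by (simp add: fun_eq_iff)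
        moreover have "\<exists>v'\<in>jones (Suc n) (Suc n). \<dots> = foldr x v'"
          using u c 2 by (intro run) auto
        ultimately show ?thesis by (simp only:)
      next
        case 3
        have "v @ [c] = u @ down (Suc n) c"
          using c j 3 down_snoc[of c "Suc n"] by simp
        then show ?thesis
          using run[OF u, of c] c by simp
      next
        case 4
        have "foldr x (v @ [c]) = foldr x ((u @ [c]) @ down (Suc n) j)"
          using far_letter[of "down (Suc n) j" c] j 4 Suc.prems(1) by (simp add: fun_eq_iff)
        moreover have "\<exists>v'\<in>jones (Suc n) (Suc n). \<dots> = foldr x v'"
          using u j 4 by (intro run) auto
        ultimately show ?thesis by (simp only:)
      qed
    qed
    then show ?case unfolding w .
  qed
qed simp

end

text \<open>The number of Jones normal forms, as given by the reflection principle.\<close>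

definition ballot :: "nat \<Rightarrow> nat \<Rightarrow> int" where
  "ballot m j = int (m + j + 1 choose j) - (if j = 0 then 0 else int (m + j + 1 choose (j - 1)))"

lemma ballot_Suc: "ballot (Suc m) (Suc j) = ballot (Suc m) j + ballot m (Suc j)"
  by (cases j) (simp_all add: ballot_def)

text \<open>This is the symmetry of row \<open>2 * m + 1\<close> of Pascal's triangle. It mirrors
  the cap \<open>min j m\<close> in \<open>jones\<close>.\<close>

lemma ballot_diagonal: "ballot m (Suc m) = ballot m m"
proof (cases m)
  case (Suc k)
  define N where "N = 2 * k + 3"
  have "(N choose Suc (Suc k)) = (N choose Suc k)"
    using binomial_symmetric[of "Suc k" N] by (simp add: N_def)
  moreover have "m + Suc m + 1 = Suc N" "m + m + 1 = N"
    by (simp_all add: N_def Suc)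
  ultimately show ?thesis
    by (simp add: ballot_def Suc)
qed (simp add: ballot_def)

text \<open>The numerical counterpart of the recursion of \<open>jones\<close>: the first summand
  stands for words without the letter \<open>m\<close>, the term for \<open>k\<close> for words with
  a final run from \<open>m\<close> down to \<open>k\<close>.\<close>

lemma ballot_sum: "ballot (Suc m) j = ballot m j + (\<Sum>k<j. ballot m k)"
  by (induction j) (simp_all add: ballot_Suc, simp add: ballot_def)

text \<open>One step off the diagonal, \<open>ballot m (Suc m)\<close> is the central binomial
  coefficient of row \<open>2 * Suc m\<close> minus its neighbour, a familiar form of the Catalan
  number.\<close>

lemma ballot_catalan: "ballot m m = int (catalan (Suc m))"
proof -
  define k a b where "k = Suc m" and "a = (2 * k choose k)" and "b = (2 * k choose m)"
  have "(2 * k - m) * b = k * a"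
    unfolding a_def b_def k_def binomial_absorb_comp binomial_absorption ..
  moreover have "2 * k - m = Suc k"
    by (simp add: k_def)
  ultimately have "real k * real a = real (Suc k) * real b"
    by (metis of_nat_mult)
  then have "real (catalan k) = real a - real b"
    unfolding catalan_eq a_def[symmetric] by (simp add: field_simps)
  moreover have "ballot m (Suc m) = int a - int b"
  proof -
    have N: "m + Suc m + 1 = 2 * k"
      by (simp add: k_def)
    show ?thesis
      unfolding ballot_def N a_def b_def by (simp add: k_def del: binomial_Suc_Suc)
  qed
  ultimately have "int (catalan k) = ballot m (Suc m)"
    by linarith
  then show ?thesis
    by (simp add: ballot_diagonal k_def)
qed

lemma finite_jones: "finite (jones m j)"
  by (induction m arbitrary: j) (auto simp: jones.simps)

text \<open>The condition on \<open>j\<close> keeps to the range where \<open>ballot\<close> counts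
  something: \<open>ballot 0 2\<close> is already \<open>0\<close>.\<close>

lemma card_jones_le:
  assumes "j \<le> m"
  shows "int (card (jones m j)) \<le> ballot m j"
  using assms
proof (induction m arbitrary: j)
  case 0
  then show ?case by (simp add: ballot_def)
next
  case (Suc m)
  have "card (jones (Suc m) j) \<le> card (jones m (min j m))
      + card (\<Union>k\<in>{..<j}. (\<lambda>w. w @ down (Suc m) k) ` jones m k)"
    unfolding jones.simps min_absorb1[OF Suc.prems] by (rule card_Un_le)
  also have "card (\<Union>k\<in>{..<j}. (\<lambda>w. w @ down (Suc m) k) ` jones m k)
      \<le> (\<Sum>k<j. card ((\<lambda>w. w @ down (Suc m) k) ` jones m k))"
    by (rule card_UN_le) simp
  also have "\<dots> \<le> (\<Sum>k<j. card (jones m k))"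
    by (intro sum_mono card_image_le finite_jones)
  finally have "int (card (jones (Suc m) j))
      \<le> int (card (jones m (min j m))) + (\<Sum>k<j. int (card (jones m k)))"
    by (simp flip: of_nat_sum of_nat_add)
  also have "\<dots> \<le> ballot m (min j m) + (\<Sum>k<j. ballot m k)"
    using Suc by (intro add_mono sum_mono) auto
  \<comment> \<open>At \<open>j = Suc m\<close> the cap lowers the index by one, which
    \<open>ballot_diagonal\<close> absorbs.\<close>
  also have "ballot m (min j m) = ballot m j"
    using Suc.prems ballot_diagonal[of m] by (cases "j = Suc m") (auto simp: min_def)
  finally show ?case
    by (simp add: ballot_sum)
qed

lemma card_jones: "card (jones m m) \<le> catalan (Suc m)"
  using card_jones_le[of m m] by (simp add: ballot_catalan)

section \<open>Hatted letters\<close>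

text \<open>The condition \<open>j \<noteq> 0\<close> is the difference from
  \<open>temperley_lieb_action\<close>: \<open>e_1 e_0 e_1\<close> does not reduce to
  \<open>e_1\<close> but is the hatted letter of index \<open>1\<close>.\<close>

locale dieck_action =
  fixes n :: nat and x :: "nat \<Rightarrow> 'a \<Rightarrow> 'a"
  assumes idem: "i < n \<Longrightarrow> x i (x i s) = x i s"
    and braid: "\<lbrakk>i < n; j < n; j = Suc i \<or> i
        = Suc j; j \<noteq> 0\<rbrakk> \<Longrightarrow> x i (x j (x i s)) = x i s"
    and far: "\<lbrakk>i < n; j < n; Suc i < j\<rbrakk> \<Longrightarrow> x i (x j s) = x j (x i s)"
begin

primrec hat :: "nat \<Rightarrow> 'a \<Rightarrow> 'a" where
  "hat 0 s = x 0 s"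
| "hat (Suc i) s = x (Suc i) (hat i (x (Suc i) s))"

lemma hat_far: "\<lbrakk>Suc i < j; j < n\<rbrakk> \<Longrightarrow> x j (hat i s) = hat i (x j s)"
proof (induction i arbitrary: s)
  case (Suc i)
  then have "x j (x (Suc i) t) = x (Suc i) (x j t)" for t
    by (simp add: far)
  then show ?case using Suc by simp
qed (simp add: far[of 0 j])

text \<open>Where the two hatted letters meet, the cubic relation contracts the middle and leaves
  the claim for the previous index. Idempotence and half of the cubic relations of the hatted
  letters come from here.\<close>

lemma hat_sandwich: "Suc i < n \<Longrightarrow> hat i (x (Suc i) (hat i s)) = hat i s"
proof (induction i arbitrary: s)
  case (Suc i)
  then show ?case by (simp add: braid)
qed (simp add: braid)

lemma hat_idem: "i < n \<Longrightarrow> hat i (hat i s) = hat i s"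
  by (cases i) (simp_all add: idem hat_sandwich)

text \<open>For adjacent indices this is \<open>hat_sandwich\<close>. Otherwise \<open>hat i\<close>
  passes the outer letter of \<open>hat (Suc j)\<close>, the induction hypothesis removes the inner
  hat, and \<open>x (Suc j)\<close>, \<open>x j\<close>, \<open>x (Suc j)\<close> contract.\<close>

lemma hat_hat_less:
  assumes "i < j" "j < n"
  shows "hat i (hat j s) = hat i (x j s)" and "hat j (hat i s) = x j (hat i s)"
proof -
  have "hat i (hat j s) = hat i (x j s) \<and> hat j (hat i s) = x j (hat i s)"
    using assms
  proof (induction j arbitrary: s)
    case (Suc j)
    show ?case
    proof (cases "i = j")
      case True
      then show ?thesis using Suc.prems by (simp add: hat_sandwich)
    next
      case False
      then have *: "i < j" "j < n" using Suc.prems by auto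
      have "hat i (hat (Suc j) s) = x (Suc j) (hat i (hat j (x (Suc j) s)))"
        using hat_far[of i "Suc j"] * Suc.prems by simp
      also have "\<dots> = hat i (x (Suc j) (x j (x (Suc j) s)))"
        using Suc.IH[OF *] hat_far[of i "Suc j"] * Suc.prems by simp
      also have "\<dots> = hat i (x (Suc j) s)"
        using * Suc.prems by (simp add: braid)
      finally have 1: "hat i (hat (Suc j) s) = hat i (x (Suc j) s)" .
      have "hat (Suc j) (hat i s) = x (Suc j) (hat j (hat i (x (Suc j) s)))"
        using hat_far[of i "Suc j"] * Suc.prems by simp
      also have "\<dots> = x (Suc j) (x j (x (Suc j) (hat i s)))"
        using Suc.IH[OF *] hat_far[of i "Suc j"] * Suc.prems by simp
      also have "\<dots> = x (Suc j) (hat i s)"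
        using * Suc.prems by (simp add: braid)
      finally show ?thesis using 1 by blast
    qed
  qed simp
  then show "hat i (hat j s) = hat i (x j s)" "hat j (hat i s) = x j (hat i s)" by auto
qed

text \<open>The hat moves from the larger index to the smaller one. For adjacent indices the outer
  letters of the inner hat supply the cubic relation; otherwise the induction hypothesis does the
  exchange one level further in.\<close>

lemma letter_hat_less:
  assumes "0 < i" "i < j" "j < n"
  shows "x i (hat j s) = hat i (x j s)" and "hat j (x i s) = x j (hat i s)"
proof -
  \<comment> \<open>A positive \<open>i\<close> makes \<open>hat i\<close> begin and end with the
    letter \<open>x i\<close>, with \<open>hat k\<close> as its core.\<close>
  obtain k where k: "i = Suc k" using assms(1) by (cases i) auto
  have "x i (hat j s) = hat i (x j s) \<and> hat j (x i s) = x j (hat i s)"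
    using assms(2,3)
  proof (induction j arbitrary: s)
    case (Suc j)
    show ?case
    proof (cases "i = j")
      case True
      then have "x j (x (Suc j) (x j t)) = x j t" for t
        using Suc.prems k by (simp add: braid)
      moreover have "hat j t = x j (hat k (x j t))" for t
        unfolding True[symmetric] k by simp
      ultimately show ?thesis
        using True by simp
    next
      case False
      then have *: "i < j" "j < n" using Suc.prems by auto
      then have c: "x i (x (Suc j) t) = x (Suc j) (x i t)" "x (Suc j) (hat i t) = hat i (x (Suc j) t)"
        "x (Suc j) (x j (x (Suc j) t)) = x (Suc j) t" for t
        using Suc.prems hat_far[of i "Suc j"] by (simp_all add: far[of i "Suc j"] braid)
      have "x i (hat (Suc j) s) = x (Suc j) (hat i (x j (x (Suc j) s)))"
        using Suc.IH[OF *] c by simp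
      moreover have "hat (Suc j) (x i s) = x (Suc j) (x j (hat i (x (Suc j) s)))"
        using Suc.IH[OF *] c(1)[symmetric] by simp
      \<comment> \<open>The two halves need \<open>hat i\<close> moved in opposite directions before
        the cubic relation applies, hence both orientations of \<open>c(2)\<close>.\<close>
      ultimately show ?thesis
        using c(3) by (simp add: c(2)) (simp add: c(2)[symmetric] c(3))
    qed
  qed simp
  then show "x i (hat j s) = hat i (x j s)" "hat j (x i s) = x j (hat i s)" by auto
qed

text \<open>This is what makes the ideal generated by the zeroth letter consist of words in hatted
  letters.\<close>

lemma letter_hat:
  assumes "i < n" "j < n"
  shows "x i (hat j s) = hat i (hat j s)" and "hat j (x i s) = hat j (hat i s)"
proof -
  consider "i = 0" | "0 < i" "i < j" | "0 < i" "i = j" | "j < i"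
    by linarith
  then have "x i (hat j s) = hat i (hat j s) \<and> hat j (x i s) = hat j (hat i s)"
  proof cases
    case 2
    then show ?thesis using assms by (simp add: letter_hat_less hat_hat_less)
  next
    case 3
    then obtain k where "i = Suc k" by (cases i) auto
    then have "x i (hat i s) = hat i s" "hat i (x i s) = hat i s"
      using assms(1) by (simp_all add: idem)
    then show ?thesis using 3 assms by (simp add: hat_idem)
  qed (use assms in \<open>simp_all add: hat_hat_less\<close>)
  then show "x i (hat j s) = hat i (hat j s)" "hat j (x i s) = hat j (hat i s)" by auto
qed

text \<open>An occurrence of \<open>0\<close> is already hatted. From it the hats spread rightwards
  by the second part of \<open>letter_hat\<close> and leftwards by the first.\<close>

lemma word_hat:
  assumes "set w \<subseteq> {..<n}" "0 \<in> set w"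
  shows "foldr x w s = foldr hat w s"
proof -
  obtain u v where w: "w = u @ 0 # v"
    using split_list[OF assms(2)] by blast
  have "hat j (foldr x v s) = hat j (foldr hat v s)" if "j < n" for j
    using assms(1) that unfolding w by (induction v arbitrary: j) (simp_all add: letter_hat)
  moreover have "foldr x u (hat j t) = foldr hat u (hat j t)" if "j < n" for j t
    using assms(1) that unfolding w
  proof (induction u arbitrary: j)
    case (Cons i u)
    have "foldr x u (hat j t) = foldr hat u (hat j t)"
      using Cons by simp
    \<comment> \<open>Whatever has been hatted so far again begins with a hatted letter, so the next
      letter on the left can receive its hat.\<close>
    moreover have "\<exists>k<n. \<exists>t'. foldr hat u (hat j t) = hat k t'"
      using Cons.prems by (cases u) auto
    ultimately show ?case using Cons.prems letter_hat(1) by auto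
  qed simp
  moreover have "0 < n" using assms by force
  ultimately show ?thesis
    by (metis (no_types, lifting) w foldr_Cons foldr_append hat.simps(1) o_apply)
qed

text \<open>By \<open>hat_hat_less\<close> the cubic relation becomes \<open>hat_sandwich\<close> if
  \<open>j = Suc i\<close>, and the recursive definition of \<open>hat i\<close> if
  \<open>i = Suc j\<close>. The index \<open>0\<close> is no exception here.\<close>

sublocale hat: temperley_lieb_action n hat
proof
  fix i j s assume ij: "i < n" "j < n" "j = Suc i \<or> i = Suc j"
  then show "hat i (hat j (hat i s)) = hat i s"
  proof (elim disjE)
    assume "j = Suc i"
    then show ?thesis using ij by (simp add: hat_hat_less hat_sandwich del: hat.simps)
  next
    assume i: "i = Suc j"
    then have "hat i (hat j (hat i s)) = x i (hat j (x i s))"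
      using ij by (simp add: hat_hat_less del: hat.simps)
    then show ?thesis using i by simp
  qed
next
  fix i j s assume "i < n" "j < n" "Suc i < j"
  then show "hat i (hat j s) = hat j (hat i s)"
    by (simp add: hat_hat_less hat_far)
qed (rule hat_idem)

text \<open>Renumbering from zero leaves \<open>n - 1\<close> letters, and a shifted index satisfies
  the condition \<open>j \<noteq> 0\<close> automatically.\<close>

sublocale unhatted: temperley_lieb_action "n - 1" "\<lambda>i. x (Suc i)"
proof
  fix i j s assume "i < n - 1" "j < n - 1" "Suc i < j"
  then show "x (Suc i) (x (Suc j) s) = x (Suc j) (x (Suc i) s)"
    by (intro far) auto
qed (auto simp: idem intro!: braid)

end

section \<open>Words in the Dieck-Temperley-Lieb algebra\<close>

definition monomial :: "nat list \<Rightarrow> freealg" where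
  "monomial w = Poly_Mapping.single (Word w) 1"

lemma monomial_append: "monomial (u @ v) = monomial u * monomial v"
  by (simp add: monomial_def mult_single plus_word_def)

lemma monomial_Nil: "monomial [] = 1"
  by (simp add: monomial_def zero_word_def[symmetric])

lemma monomial_letter: "monomial [i] = var i"
  by (simp add: monomial_def var_def)

lemma monomial_closed: "set w \<subseteq> {..<n} \<Longrightarrow> monomial w \<in> carrier (free_algebra n)"
  by (simp add: monomial_def free_algebra_def)

lemma scalar_mult_closed:
  "f \<in> carrier (free_algebra n) \<Longrightarrow> scalar c * f \<in> carrier (free_algebra n)"
  using free_algebra_closed(5) by blast

lemma free_algebra_zero: "0 \<in> carrier (free_algebra n)"
  by (simp add: free_algebra_def)

abbreviation dtl_class :: "nat \<Rightarrow> freealg \<Rightarrow> freealg set" where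
  "dtl_class n f \<equiv> dtl_ideal n +>\<^bsub>free_algebra n\<^esub> f"

lemma carrier_DTL: "carrier (DTL n) = dtl_class n ` carrier (free_algebra n)"
  by (auto simp: DTL_ops FactRing_simps)

lemma dtl_class_closed: "f \<in> carrier (free_algebra n) \<Longrightarrow> dtl_class n f \<in> carrier (DTL n)"
  by (simp add: carrier_DTL)

lemma dtl_class_ops:
  assumes "f \<in> carrier (free_algebra n)" "g \<in> carrier (free_algebra n)"
  shows "dtl_class n f \<oplus>\<^bsub>DTL n\<^esub> dtl_class n g = dtl_class n (f + g)"
    and "dtl_class n f \<otimes>\<^bsub>DTL n\<^esub> dtl_class n g = dtl_class n (f * g)"
proof -
  interpret I: ideal "dtl_ideal n" "free_algebra n" by (rule ideal_dtl_ideal)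
  show "dtl_class n f \<oplus>\<^bsub>DTL n\<^esub> dtl_class n g = dtl_class n (f + g)"
    "dtl_class n f \<otimes>\<^bsub>DTL n\<^esub> dtl_class n g = dtl_class n (f * g)"
    using I.a_rcos_sum[OF assms] I.rcoset_mult_add[OF assms]
    by (simp_all add: DTL_ops FactRing_def) (simp_all add: free_algebra_def)
qed

lemma one_DTL: "\<one>\<^bsub>DTL n\<^esub> = dtl_class n 1"
  by (simp add: DTL_ops FactRing_def) (simp add: free_algebra_def)

lemma zero_DTL: "\<zero>\<^bsub>DTL n\<^esub> = dtl_class n 0"
proof -
  interpret I: ideal "dtl_ideal n" "free_algebra n" by (rule ideal_dtl_ideal)
  have "dtl_class n 0 = dtl_ideal n"
    using I.a_coset_add_zero[OF I.a_subset] by (simp add: free_algebra_def)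
  then show ?thesis
    by (simp add: DTL_ops FactRing_def)
qed

lemma dtl_class_eq_iff:
  assumes "f \<in> carrier (free_algebra n)" "g \<in> carrier (free_algebra n)"
  shows "dtl_class n f = dtl_class n g \<longleftrightarrow> f - g \<in> dtl_ideal n"
proof -
  interpret I: ideal "dtl_ideal n" "free_algebra n" by (rule ideal_dtl_ideal)
  have add: "x \<oplus>\<^bsub>free_algebra n\<^esub> y = x + y" for x y
    by (simp add: free_algebra_def)
  have "f \<in> dtl_class n g \<longleftrightarrow> f - g \<in> dtl_ideal n"
    by (auto simp: a_r_coset_def' add) (metis diff_add_cancel)
  then show ?thesis
    using I.a_rcos_self[OF assms(1)] I.a_repr_independence'[of f g] assms(2) by metis
qed

lemma dtl_class_relation:
  assumes "f - g \<in> dtl_relations n" "f \<in> carrier (free_algebra n)" "g \<in> carrier (free_algebra n)"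
  shows "dtl_class n f = dtl_class n g"
proof -
  have "f - g \<in> dtl_ideal n"
    unfolding dtl_ideal_def
    by (rule subsetD[OF ring.genideal_self[OF ring_free_algebra dtl_relations_subset] assms(1)])
  then show ?thesis
    by (rule iffD2[OF dtl_class_eq_iff[OF assms(2,3)]])
qed

lemma free_algebra_induct [consumes 1, case_names zero add]:
  assumes "f \<in> carrier (free_algebra n)" "P 0"
    and "\<And>c w f. \<lbrakk>set w \<subseteq> {..<n}; f \<in> carrier (free_algebra n); P f\<rbrakk>
      \<Longrightarrow> P (scalar c * monomial w + f)"
  shows "P f"
  using assms(1)
proof (induction f rule: update_induct)
  case (update f w a)
  have "Poly_Mapping.update w a f = scalar a * monomial (letters w) + f"
    using update(1) by (intro poly_mapping_eqI)
      (auto simp: lookup_update lookup_add lookup_single in_keys_iff when_def monomial_def scalar_mult_single)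
  moreover have "f \<in> carrier (free_algebra n)" "set (letters w) \<subseteq> {..<n}"
    using update by (auto simp: free_algebra_def keys_update)
  ultimately show ?case
    using assms(3) update(3) by simp
qed (rule assms(2))

text \<open>Any integer exponent of the unit \<open>\<delta>\<close> is allowed, which makes the
  relation symmetric. The bounds on the letters keep both words in the free algebra on
  \<open>n\<close> letters.\<close>

definition proportional :: "nat \<Rightarrow> nat list \<Rightarrow> nat list \<Rightarrow> bool" where
  "proportional n u v \<longleftrightarrow> set u \<subseteq> {..<n} \<and> set v \<subseteq> {..<n} \<and>
    (\<exists>k. dtl_class n (monomial u)
        = Poly_Mapping.single k 1 \<odot>\<^bsub>DTL n\<^esub> dtl_class n (monomial v))"

lemma proportionalI:
  assumes "set u \<subseteq> {..<n}" "set v \<subseteq> {..<n}"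
    and "dtl_class n (monomial u) = dtl_class n (scalar (Poly_Mapping.single k 1) * monomial v)"
  shows "proportional n u v"
  using assms by (auto simp: proportional_def smult_DTL monomial_closed)

lemma proportionalE:
  assumes "proportional n u v"
  obtains k where "set u \<subseteq> {..<n}" "set v \<subseteq> {..<n}"
    "dtl_class n (monomial u) = dtl_class n (scalar (Poly_Mapping.single k 1) * monomial v)"
  using assms by (auto simp: proportional_def smult_DTL monomial_closed)

lemma proportional_refl: "set u \<subseteq> {..<n} \<Longrightarrow> proportional n u u"
  by (rule proportionalI[where k = 0]) (simp_all add: scalar_hom(3))

lemma smult_single:
  assumes "f \<in> carrier (free_algebra n)"
  shows "Poly_Mapping.single k 1 \<odot>\<^bsub>DTL n\<^esub> (Poly_Mapping.single l 1 \<odot>\<^bsub>DTL n\<^esub> dtl_class n f)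
    = Poly_Mapping.single (k + l) 1 \<odot>\<^bsub>DTL n\<^esub> dtl_class n f"
  using assms
  by (simp add: smult_DTL scalar_mult_closed mult.assoc[symmetric] scalar_hom(2)[symmetric] mult_single)

lemma proportional_trans: "\<lbrakk>proportional n u v; proportional n v w\<rbrakk> \<Longrightarrow> proportional n u w"
  by (auto simp: proportional_def smult_single monomial_closed)

lemma proportional_sym:
  assumes "proportional n u v"
  shows "proportional n v u"
proof -
  obtain k where k: "dtl_class n (monomial u)
      = Poly_Mapping.single k 1 \<odot>\<^bsub>DTL n\<^esub> dtl_class n (monomial v)"
    and uv: "set u \<subseteq> {..<n}" "set v \<subseteq> {..<n}"
    using assms by (auto simp: proportional_def)
  have "Poly_Mapping.single (- k) 1 \<odot>\<^bsub>DTL n\<^esub> dtl_class n (monomial u)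
      = dtl_class n (monomial v)"
    unfolding k using uv
    by (simp add: smult_single monomial_closed) (simp add: smult_DTL monomial_closed scalar_hom(3))
  then show ?thesis
    using uv by (auto simp: proportional_def intro: sym)
qed

lemma proportional_context:
  assumes "proportional n u v" "set p \<subseteq> {..<n}" "set s \<subseteq> {..<n}"
  shows "proportional n (p @ u @ s) (p @ v @ s)"
proof -
  obtain k where uv: "set u \<subseteq> {..<n}" "set v \<subseteq> {..<n}"
    and k: "dtl_class n (monomial u) = dtl_class n (scalar (Poly_Mapping.single k 1) * monomial v)"
      (is "_ = dtl_class n (?c * _)")
    using assms(1) by (rule proportionalE)
  note closed = monomial_closed scalar_mult_closed free_algebra_closed(4) assms(2,3) uv
  have "dtl_class n (monomial (p @ u @ s))
      = dtl_class n (monomial p) \<otimes>\<^bsub>DTL n\<^esub> (dtl_class n (monomial u) \<otimes>\<^bsub>DTL n\<^esub> dtl_class n (monomial s))"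
    by (simp add: monomial_append dtl_class_ops closed)
  also have "\<dots> = dtl_class n (monomial p * (?c * monomial v * monomial s))"
    unfolding k by (simp add: dtl_class_ops closed)
  also have "monomial p * (?c * monomial v * monomial s) = ?c * monomial (p @ v @ s)"
    by (simp add: monomial_append mult.assoc[symmetric] scalar_central[of _ "monomial p"])
  finally show ?thesis
    using assms(2,3) uv by (intro proportionalI[where k = k]) auto
qed

lemma proportional_relation:
  assumes "monomial u - scalar (Poly_Mapping.single k 1) * monomial v \<in> dtl_relations n"
    and "set u \<subseteq> {..<n}" "set v \<subseteq> {..<n}"
  shows "proportional n u v"
  by (rule proportionalI[OF assms(2,3) dtl_class_relation[OF assms(1)]])
    (intro scalar_mult_closed monomial_closed assms)+

lemma monomial_Cons: "monomial (i # w) = var i * monomial w"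
  using monomial_append[of "[i]" w] by (simp add: monomial_letter)

lemma proportional_idem:
  assumes "i < n"
  shows "proportional n [i, i] [i]"
proof (cases "i = 0")
  case True
  have "\<delta>\<^sup>2 = Poly_Mapping.single 2 1"
    by (simp add: \<delta>_def power2_eq_square mult_single)
  then show ?thesis
    using True assms dtl_relations.square_0[of n]
    by (intro proportional_relation[of _ 2]) (simp_all add: monomial_Cons monomial_Nil)
next
  case False
  then show ?thesis
    using assms dtl_relations.square[of i n]
    by (intro proportional_relation[of _ 1]) (simp_all add: monomial_Cons monomial_Nil \<delta>_def)
qed

text \<open>The condition on \<open>j\<close> selects exactly the relations \<open>cubic_0\<close>
  and \<open>cubic\<close>, with exponents \<open>1\<close> and \<open>0\<close>.\<close>

lemma proportional_braid:
  assumes "i < n" "j < n" "j = Suc i \<or> i = Suc j" "j \<noteq> 0"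
  shows "proportional n [i, j, i] [i]"
proof (cases "i = 0")
  case True
  then have "j = 1" using assms by auto
  then show ?thesis
    using True assms dtl_relations.cubic_0[of n]
    by (intro proportional_relation[of _ 1]) (simp_all add: monomial_Cons monomial_Nil \<delta>_def mult.assoc)
next
  case False
  then have "var i * var j * var i - var i \<in> dtl_relations n"
    using assms by (intro dtl_relations.cubic) auto
  then show ?thesis
    using assms
    by (intro proportional_relation[of _ 0])
      (simp_all add: monomial_Cons monomial_Nil mult.assoc scalar_hom(3))
qed

lemma proportional_far:
  assumes "i < n" "j < n" "Suc i < j"
  shows "proportional n [i, j] [j, i]"
proof -
  have "var i * var j - var j * var i \<in> dtl_relations n"
    using assms by (intro dtl_relations.commute) auto
  then show ?thesis
    using assms
    by (intro proportional_relation[of _ 0]) (simp_all add: monomial_Cons monomial_Nil scalar_hom(3))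
qed

text \<open>Through the action on sets of words, relations that hold up to a power of \<open>\<delta>\<close> become
  equations between functions.\<close>

definition act :: "nat \<Rightarrow> nat \<Rightarrow> nat list set \<Rightarrow> nat list set" where
  "act n i C = {v. \<exists>w\<in>C. proportional n v (i # w)}"

lemma proportional_set: "proportional n u v \<Longrightarrow> set u \<subseteq> {..<n} \<and> set v \<subseteq> {..<n}"
  by (simp add: proportional_def)

text \<open>For the empty word the right-hand side would be the closure of \<open>C\<close> under
  proportionality, which may differ from \<open>C\<close>.\<close>

lemma act_word:
  assumes "u \<noteq> []"
  shows "foldr (act n) u C = {v. \<exists>w\<in>C. proportional n v (u @ w)}"
  using assms
proof (induction u)
  case (Cons i u)
  show ?case
  proof (cases "u = []")
    case False
    have "(\<exists>t. (\<exists>w\<in>C. proportional n t (u @ w)) \<and> proportional n v (i # t))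
      \<longleftrightarrow> (\<exists>w\<in>C. proportional n v (i # u @ w))" for v
    proof safe
      fix t w assume "w \<in> C" "proportional n t (u @ w)" "proportional n v (i # t)"
      moreover from this have "proportional n (i # t) (i # u @ w)"
        using proportional_context[of n t "u @ w" "[i]" "[]"] proportional_set[of n v "i # t"] by simp
      ultimately show "\<exists>w\<in>C. proportional n v (i # u @ w)"
        using proportional_trans by blast
    next
      fix w assume "w \<in> C" "proportional n v (i # u @ w)"
      then show "\<exists>t. (\<exists>w\<in>C. proportional n t (u @ w)) \<and> proportional n v (i # t)"
        using proportional_refl[of "u @ w" n] proportional_set[of n v "i # u @ w"] by auto
    qed
    then show ?thesis
      using Cons False by (simp add: act_def Bex_def)
  qed (simp add: act_def)
qed simp

lemma act_word_eq:
  assumes "proportional n u v" "u \<noteq> []" "v \<noteq> []"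
  shows "foldr (act n) u C = foldr (act n) v C"
proof -
  have "proportional n t (u' @ w) \<Longrightarrow> proportional n t (v' @ w)" if "proportional n u' v'" for t w u' v'
    using proportional_context[OF that, of "[]" w] proportional_trans proportional_set[of n t "u' @ w"] by auto
  then show ?thesis
    using assms proportional_sym[OF assms(1)] unfolding act_word[OF assms(2)] act_word[OF assms(3)] by blast
qed

text \<open>The class of the empty word serves as base point: it is closed under proportionality,
  and evaluation there lets \<open>proportional_act\<close> turn equal actions back into
  proportional words.\<close>

lemma act_base:
  assumes "set u \<subseteq> {..<n}"
  shows "foldr (act n) u {v. proportional n v []} = {v. proportional n v u}"
proof (cases "u = []")
  case False
  have "(\<exists>w. proportional n w [] \<and> proportional n v (u @ w)) \<longleftrightarrow> proportional n v u" for v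
    using proportional_context[of n _ "[]" u "[]"] proportional_trans[of n v] proportional_refl[of "[]" n] assms
    by fastforce
  then show ?thesis
    using act_word[OF False] by auto
qed simp

lemma proportional_act:
  assumes "foldr (act n) u = foldr (act n) v" "set u \<subseteq> {..<n}" "set v \<subseteq> {..<n}"
  shows "proportional n u v"
proof -
  have "u \<in> {w. proportional n w u}"
    using assms(2) by (simp add: proportional_refl)
  then show ?thesis
    using act_base[OF assms(2)] act_base[OF assms(3)] assms(1) by auto
qed

interpretation dieck_action n "act n" for n
proof
  fix i j C
  show "act n i (act n i C) = act n i C" if "i < n"
    using act_word_eq[OF proportional_idem[OF that]] by simp
  show "act n i (act n j (act n i C)) = act n i C"
    if "i < n" "j < n" "j = Suc i \<or> i = Suc j" "j \<noteq> 0"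
    using act_word_eq[OF proportional_braid[OF that]] by simp
  show "act n i (act n j C) = act n j (act n i C)" if "i < n" "j < n" "Suc i < j"
    using act_word_eq[OF proportional_far[OF that]] by simp
qed

section \<open>Hatted letters as words, and the normal words of the algebra\<close>

primrec hat_word :: "nat \<Rightarrow> nat list" where
  "hat_word 0 = [0]"
| "hat_word (Suc i) = Suc i # hat_word i @ [Suc i]"

lemma hat_word_letters: "set (hat_word i) = {..i}"
  by (induction i) auto

lemma foldr_hat: "foldr (hat n) w = foldr (act n) (concat (map hat_word w))"
proof -
  have "hat n i C = foldr (act n) (hat_word i) C" for i C
    by (induction i arbitrary: C) auto
  then show ?thesis
    by (induction w) (auto simp: fun_eq_iff)
qed

lemma hat_words_letters:
  "set w \<subseteq> {..<n} \<Longrightarrow> set (concat (map hat_word w)) \<subseteq> {..<n}"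
  by (auto simp: hat_word_letters dest!: subsetD intro: le_less_trans)

lemma proportional_hat:
  assumes "set w \<subseteq> {..<n}" "0 \<in> set w"
  shows "proportional n w (concat (map hat_word w))"
proof (rule proportional_act[OF ext assms(1) hat_words_letters[OF assms(1)]])
  show "foldr (act n) w C = foldr (act n) (concat (map hat_word w)) C" for C
    unfolding foldr_hat[symmetric] by (rule word_hat[OF assms])
qed

text \<open>The first family represents the words without the letter \<open>0\<close>, in
  \<open>n - 1\<close> shifted letters; the second represents the words containing \<open>0\<close>,
  in \<open>n\<close> hatted letters.\<close>

definition normal_words :: "nat \<Rightarrow> nat list set" where
  "normal_words n = map Suc ` jones (n - 1) (n - 1)
     \<union> (\<lambda>w. concat (map hat_word w)) ` jones n n"

lemma normal_words_letters:
  assumes "w \<in> normal_words n"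
  shows "set w \<subseteq> {..<n}"
  using assms unfolding normal_words_def
proof
  assume "w \<in> map Suc ` jones (n - 1) (n - 1)"
  then obtain v where "w = map Suc v" "set v \<subseteq> {..<n - 1}"
    using jones_letters by blast
  then show ?thesis by auto
next
  assume "w \<in> (\<lambda>w. concat (map hat_word w)) ` jones n n"
  then obtain v where v: "w = concat (map hat_word v)" "set v \<subseteq> {..<n}"
    using jones_letters by blast
  show ?thesis
    unfolding v(1) by (rule hat_words_letters[OF v(2)])
qed

lemma proportional_normal_word:
  assumes w: "set w \<subseteq> {..<n}"
  shows "\<exists>v\<in>normal_words n. proportional n w v"
proof (cases "0 \<in> set w")
  case True
  obtain v where v: "v \<in> jones n n" "foldr (hat n) w = foldr (hat n) v"
    using hat.jones_normal_form[OF order_refl w] by blast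
  have "foldr (act n) w = foldr (act n) (concat (map hat_word v))"
    using word_hat[OF w True] v(2) by (auto simp: fun_eq_iff foldr_hat)
  then have "proportional n w (concat (map hat_word v))"
    using w hat_words_letters jones_letters[OF v(1)] by (intro proportional_act) auto
  then show ?thesis
    using v(1) by (auto simp: normal_words_def)
next
  case False
  obtain u where u: "w = map Suc u"
    using False by (metis Suc_pred' ex_map_conv gr0I)
  then have "set u \<subseteq> {..<n - 1}"
    using w by auto
  then obtain v where v: "v \<in> jones (n - 1) (n - 1)"
    "foldr (\<lambda>i. act n (Suc i)) u = foldr (\<lambda>i. act n (Suc i)) v"
    using unhatted.jones_normal_form[OF order_refl] by blast
  have "foldr (act n) w = foldr (act n) (map Suc v)"
    using v(2) u by (simp add: fun_eq_iff foldr_map comp_def)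
  moreover have "set (map Suc v) \<subseteq> {..<n}"
    using jones_letters[OF v(1)] by auto
  ultimately have "proportional n w (map Suc v)"
    using w by (intro proportional_act)
  then show ?thesis
    using v(1) by (auto simp: normal_words_def)
qed

lemma finite_normal_words: "finite (normal_words n)"
  by (simp add: normal_words_def finite_jones)

lemma card_normal_words:
  assumes "n \<ge> 1"
  shows "card (normal_words n) \<le> catalan n + catalan (n + 1) - 1"
proof -
  define A B where "A = map Suc ` jones (n - 1) (n - 1)"
    and "B = (\<lambda>w. concat (map hat_word w)) ` jones n n"
  have fin: "finite A" "finite B"
    by (simp_all add: A_def B_def finite_jones)
  \<comment> \<open>The common empty word accounts for the subtraction of one.\<close>
  have "[] \<in> A \<inter> B"
    unfolding A_def B_def using Nil_in_jones by force
  then have "card (A \<inter> B) \<ge> 1"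
    using fin by (metis One_nat_def Suc_leI card_gt_0_iff empty_iff finite_Int)
  moreover have "card A \<le> catalan n"
    using card_image_le[OF finite_jones, of "map Suc" "n - 1" "n - 1"] card_jones[of "n - 1"] assms
    by (simp add: A_def)
  moreover have "card B \<le> catalan (n + 1)"
    using order_trans[OF card_image_le[OF finite_jones] card_jones] by (simp add: B_def)
  ultimately show ?thesis
    using card_Un_Int[OF fin] unfolding normal_words_def A_def[symmetric] B_def[symmetric] by linarith
qed

text \<open>Every element is the class of a combination of words, so a submodule can be tested on
  words. Both claims of the theorem are reduced in this way.\<close>

lemma span_monomials:
  assumes H: "submodule H laurent_ring (DTL n)"
    and "\<And>w. set w \<subseteq> {..<n} \<Longrightarrow> dtl_class n (monomial w) \<in> H"
  shows "H = carrier (DTL n)"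
proof
  note E = module.submoduleE[OF module_DTL H]
  show "H \<subseteq> carrier (DTL n)" by (rule E(1))
  have "dtl_class n f \<in> H" if "f \<in> carrier (free_algebra n)" for f
    using that
  proof (induction f rule: free_algebra_induct)
    case zero
    then show ?case
      using subgroup.one_closed[OF submodule.axioms(1)[OF H]] by (simp add: zero_DTL)
  next
    case (add c w f)
    have "dtl_class n (scalar c * monomial w + f)
        = (c \<odot>\<^bsub>DTL n\<^esub> dtl_class n (monomial w)) \<oplus>\<^bsub>DTL n\<^esub> dtl_class n f"
      using add by (simp add: dtl_class_ops scalar_mult_closed monomial_closed smult_DTL)
    also have "\<dots> \<in> H"
      using add assms(2) by (intro E(4,5)) (auto simp: laurent_ring_def)
    finally show ?case .
  qed
  then show "carrier (DTL n) \<subseteq> H"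
    by (auto simp: carrier_DTL)
qed

lemma submodule_proportional:
  assumes "submodule H laurent_ring (DTL n)" "proportional n u v" "dtl_class n (monomial v) \<in> H"
  shows "dtl_class n (monomial u) \<in> H"
proof -
  obtain k where k: "dtl_class n (monomial u)
      = Poly_Mapping.single k 1 \<odot>\<^bsub>DTL n\<^esub> dtl_class n (monomial v)"
    using assms(2) by (auto simp: proportional_def)
  show ?thesis
    unfolding k by (rule module.submoduleE(4)[OF module_DTL assms(1) _ assms(3)]) (simp add: laurent_ring_def)
qed

lemma (in module) submodule_set_add:
  assumes "submodule H R M" "submodule K R M"
  shows "submodule (H <+>\<^bsub>M\<^esub> K) R M"
proof -
  note H = submoduleE[OF assms(1)] and K = submoduleE[OF assms(2)]
  have HK: "h \<oplus>\<^bsub>M\<^esub> k \<in> H <+>\<^bsub>M\<^esub> K" if "h \<in> H" "k \<in> K" for h k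
    using that by (auto simp: set_add_def')
  have zero: "\<zero>\<^bsub>M\<^esub> \<in> H" "\<zero>\<^bsub>M\<^esub> \<in> K"
    using subgroup.one_closed[OF submodule.axioms(1)[OF assms(1)]]
      subgroup.one_closed[OF submodule.axioms(1)[OF assms(2)]] by simp_all
  show ?thesis
  proof (rule submoduleI)
    show "H <+>\<^bsub>M\<^esub> K \<subseteq> carrier M"
      using H(1) K(1) by (auto simp: set_add_def')
    show "\<zero>\<^bsub>M\<^esub> \<in> H <+>\<^bsub>M\<^esub> K"
      using HK[OF zero] by simp
  next
    fix a assume "a \<in> H <+>\<^bsub>M\<^esub> K"
    then obtain h k where a: "h \<in> H" "k \<in> K" "a = h \<oplus>\<^bsub>M\<^esub> k"
      by (auto simp: set_add_def')
    have c: "h \<in> carrier M" "k \<in> carrier M"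
      using a H(1) K(1) by auto
    show "\<ominus>\<^bsub>M\<^esub> a \<in> H <+>\<^bsub>M\<^esub> K"
      using HK[OF H(3)[OF a(1)] K(3)[OF a(2)]] by (simp add: a(3) M.minus_add c)
    show "r \<odot>\<^bsub>M\<^esub> a \<in> H <+>\<^bsub>M\<^esub> K" if "r \<in> carrier R" for r
      using HK[OF H(4)[OF that a(1)] K(4)[OF that a(2)]] by (simp add: a(3) smult_r_distr c that)
    fix b assume "b \<in> H <+>\<^bsub>M\<^esub> K"
    then obtain h' k' where b: "h' \<in> H" "k' \<in> K" "b = h' \<oplus>\<^bsub>M\<^esub> k'"
      by (auto simp: set_add_def')
    have c': "h' \<in> carrier M" "k' \<in> carrier M"
      using b H(1) K(1) by auto
    have "a \<oplus>\<^bsub>M\<^esub> b = (h \<oplus>\<^bsub>M\<^esub> h') \<oplus>\<^bsub>M\<^esub> (k \<oplus>\<^bsub>M\<^esub> k')"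
      by (simp add: a(3) b(3) c c' M.a_ac)
    then show "a \<oplus>\<^bsub>M\<^esub> b \<in> H <+>\<^bsub>M\<^esub> K"
      using HK[OF H(5)[OF a(1) b(1)] K(5)[OF a(2) b(2)]] by simp
  qed
qed

lemma unital_subalgebra_generated:
  assumes "S \<subseteq> carrier (DTL n)"
  shows "unital_subalgebra laurent_ring (DTL n) (subalgebra_generated laurent_ring (DTL n) S)"
proof -
  let ?F = "{H. unital_subalgebra laurent_ring (DTL n) H \<and> S \<subseteq> H}"
  \<comment> \<open>The intersection is over a nonempty family, since the whole algebra belongs to
    it.\<close>
  have carr: "carrier (DTL n) \<in> ?F"
    using assms ring.carrier_is_subring[OF ring_DTL] module.carrier_is_submodule[OF module_DTL]
    by (simp add: unital_subalgebra_def)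
  have ring: "subring (\<Inter>?F) (DTL n)"
    using carr by (intro ring.subring_Inter[OF ring_DTL]) (auto simp: unital_subalgebra_def)
  moreover have "submodule (\<Inter>?F) laurent_ring (DTL n)"
  proof (rule submodule.intro)
    show "subgroup (\<Inter>?F) (add_monoid (DTL n))"
      using ring by (rule subring.axioms)
    show "submodule_axioms (\<Inter>?F) laurent_ring (DTL n)"
      using submodule.smult_closed by (fastforce simp: submodule_axioms_def unital_subalgebra_def)
  qed
  ultimately show ?thesis
    by (simp add: subalgebra_generated_def hull_def unital_subalgebra_def)
qed

lemma subalgebra_generated_superset: "S \<subseteq> subalgebra_generated R A S"
  unfolding subalgebra_generated_def by (rule hull_subset)

lemma dtl_e_hat_eq: "i < n \<Longrightarrow> dtl_e_hat n i = dtl_class n (monomial (hat_word i))"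
proof (induction i)
  case 0
  then show ?case by (simp add: dtl_e_def monomial_letter)
next
  case (Suc i)
  have e: "dtl_e n (Suc i) = dtl_class n (monomial [Suc i])"
    by (simp add: dtl_e_def monomial_letter)
  \<comment> \<open>As the hatted letter of index \<open>0\<close> is \<open>e_0\<close> itself,
    both recursive clauses have this shape.\<close>
  have "dtl_e_hat n (Suc i) = dtl_e n (Suc i) \<otimes>\<^bsub>DTL n\<^esub> dtl_e_hat n i \<otimes>\<^bsub>DTL n\<^esub> dtl_e n (Suc i)"
    by (cases i) simp_all
  also have "\<dots> = dtl_class n (monomial [Suc i] * monomial (hat_word i) * monomial [Suc i])"
    using Suc by (simp add: e dtl_class_ops monomial_closed free_algebra_closed(4) hat_word_letters subset_iff)
  finally show ?case
    by (simp add: monomial_append[symmetric])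
qed

text \<open>Applied with \<open>f = hat_word\<close> for the second subalgebra and with one-letter
  words for the first.\<close>

lemma subring_words:
  assumes "subring H (DTL n)" "\<And>i. i \<in> set w \<Longrightarrow> dtl_class n (monomial (f i)) \<in> H"
    and "\<And>i. i \<in> set w \<Longrightarrow> set (f i) \<subseteq> {..<n}"
  shows "dtl_class n (monomial (concat (map f w))) \<in> H"
  using assms(2,3)
proof (induction w)
  case Nil
  then show ?case
    using subringE(3)[OF assms(1)] by (simp add: monomial_Nil one_DTL)
next
  case (Cons i w)
  have "set (concat (map f w)) \<subseteq> {..<n}"
    using Cons.prems(2) by fastforce
  then have "dtl_class n (monomial (concat (map f (i # w))))
      = dtl_class n (monomial (f i)) \<otimes>\<^bsub>DTL n\<^esub> dtl_class n (monomial (concat (map f w)))"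
    using Cons.prems(2)[of i] by (simp add: monomial_append dtl_class_ops monomial_closed)
  then show ?case
    using subringE(6)[OF assms(1)] Cons by simp
qed

section \<open>Constant coefficients and the infinitude of the algebra\<close>

lemma lookup_mult_0: "Poly_Mapping.lookup (f * g) (0 :: word)
    = Poly_Mapping.lookup f 0 * Poly_Mapping.lookup g 0"
  for f g :: freealg
proof -
  have split: "(0 :: word) = u + v \<longleftrightarrow> u = 0 \<and> v = 0" for u v
    by (cases u; cases v) (auto simp: zero_word_def plus_word_def)
  have "(\<Sum>v. Poly_Mapping.lookup g v when (0 :: word) = u + v) = (Poly_Mapping.lookup g 0 when u
      = 0)" for u
    by (simp add: split when_def)
  then show ?thesis
    by (simp add: lookup_mult mult_when)
qed

text \<open>The augmentation sending every letter to zero is multiplicative by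
  \<open>lookup_mult_0\<close> and kills all relations, so its kernel contains the ideal.\<close>

lemma dtl_ideal_lookup_0:
  assumes "f \<in> dtl_ideal n"
  shows "Poly_Mapping.lookup f 0 = 0"
proof -
  let ?K = "{f \<in> carrier (free_algebra n). Poly_Mapping.lookup f 0 = 0}"
  have var: "Poly_Mapping.lookup (var i) 0 = 0" for i
    by (simp add: var_def lookup_single zero_word_def)
  have "ideal ?K (free_algebra n)"
  proof (rule idealI[OF ring_free_algebra])
    interpret ring "free_algebra n" by (rule ring_free_algebra)
    have add: "x \<oplus>\<^bsub>free_algebra n\<^esub> y
        = x + y" "x \<otimes>\<^bsub>free_algebra n\<^esub> y = x * y" for x y
      by (simp_all add: free_algebra_def)
    note closed = free_algebra_closed(1,4) free_algebra_closed(3)[OF _ free_algebra_zero]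
    have neg: "\<ominus>\<^bsub>free_algebra n\<^esub> x = - x" if "x \<in> carrier (free_algebra n)" for x
    proof (rule minus_equality)
      show "- x \<oplus>\<^bsub>free_algebra n\<^esub> x = \<zero>\<^bsub>free_algebra n\<^esub>"
        by (simp add: free_algebra_def)
    qed (rule that closed(3))+
    show "subgroup ?K (add_monoid (free_algebra n))"
    proof (rule add.subgroupI)
      have "0 \<in> ?K"
        using free_algebra_zero by simp
      then show "?K \<noteq> {}"
        by blast
    next
      fix a b assume "a \<in> ?K" "b \<in> ?K"
      then show "a \<oplus>\<^bsub>free_algebra n\<^esub> b \<in> ?K"
        unfolding add using closed(1)[of a n b] by (simp add: lookup_add)
    next
      fix a assume "a \<in> ?K"
      then show "\<ominus>\<^bsub>free_algebra n\<^esub> a \<in> ?K"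
        using neg[of a] closed(3)[of a] by simp
    qed blast
    show "x \<otimes>\<^bsub>free_algebra n\<^esub> a \<in> ?K" "a \<otimes>\<^bsub>free_algebra n\<^esub> x \<in> ?K"
      if "a \<in> ?K" "x \<in> carrier (free_algebra n)" for a x
      unfolding add using that closed(2)[of a n x] closed(2)[of x n a]
      by (simp_all add: lookup_mult_0)
  qed
  moreover have "dtl_relations n \<subseteq> ?K"
  proof
    fix r assume r: "r \<in> dtl_relations n"
    then have "Poly_Mapping.lookup r 0 = 0"
      by cases (simp_all add: lookup_minus lookup_mult_0 var)
    then show "r \<in> ?K"
      using dtl_relations_subset r by blast
  qed
  ultimately have "dtl_ideal n \<subseteq> ?K"
    unfolding dtl_ideal_def by (rule ring.genideal_minimal[OF ring_free_algebra])
  then show ?thesis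
    using assms by blast
qed

text \<open>Distinct powers of \<open>\<delta>\<close> stay distinct because their difference has a
  nonzero constant coefficient. This supplies the elements with which the spanning set is
  padded.\<close>

lemma infinite_DTL: "infinite (carrier (DTL n))"
proof -
  define f where "f k = scalar (Poly_Mapping.single k 1)" for k :: int
  have f: "f k \<in> carrier (free_algebra n)" for k
    using scalar_mult_closed[of 1 n] monomial_closed[of "[]" n] by (simp add: f_def monomial_Nil)
  have "inj (\<lambda>k. dtl_class n (f k))"
  proof
    fix k l assume "dtl_class n (f k) = dtl_class n (f l)"
    then have "Poly_Mapping.lookup (f k - f l) 0 = 0"
      using dtl_ideal_lookup_0 dtl_class_eq_iff f by blast
    then have "Poly_Mapping.single k (1 :: int) = Poly_Mapping.single l 1"
      by (simp add: f_def scalar_def lookup_minus)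
    then show "k = l"
      by (metis lookup_single_eq lookup_single_not_eq zero_neq_one)
  qed
  moreover have "range (\<lambda>k. dtl_class n (f k)) \<subseteq> carrier (DTL n)"
    using f by (auto intro: dtl_class_closed)
  ultimately show ?thesis
    using infinite_UNIV_int finite_imageD finite_subset by blast
qed

theorem proposition7p4:
  fixes n :: nat
  assumes "n \<ge> 1"
  shows
    "carrier (DTL n) =
       subalgebra_generated laurent_ring (DTL n) (dtl_e n ` {1..n - 1})
         <+>\<^bsub>DTL n\<^esub>
       subalgebra_generated laurent_ring (DTL n) (dtl_e_hat n ` {0..n - 1})
     \<and>
     (\<exists>S. S \<subseteq> carrier (DTL n) \<and> finite S \<and>
          card S = catalan n + catalan (n + 1) - 1 \<and>
          module_span laurent_ring (DTL n) S = carrier (DTL n))"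
proof
  let ?e = "dtl_e n ` {1..n - 1}" and ?h = "dtl_e_hat n ` {0..n - 1}"
  define Y1 Y2 where "Y1 = subalgebra_generated laurent_ring (DTL n) ?e"
    and "Y2 = subalgebra_generated laurent_ring (DTL n) ?h"
  have e: "dtl_e n i = dtl_class n (monomial [i])" for i
    by (simp add: dtl_e_def monomial_letter)
  have "?e \<subseteq> carrier (DTL n)"
    by (auto simp: e intro!: dtl_class_closed monomial_closed)
  then have Y1: "subring Y1 (DTL n)" "submodule Y1 laurent_ring (DTL n)"
    using unital_subalgebra_generated by (auto simp: Y1_def unital_subalgebra_def)
  have "?h \<subseteq> carrier (DTL n)"
    using assms by (auto simp: dtl_e_hat_eq hat_word_letters intro!: dtl_class_closed monomial_closed)
  then have Y2: "subring Y2 (DTL n)" "submodule Y2 laurent_ring (DTL n)"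
    using unital_subalgebra_generated by (auto simp: Y2_def unital_subalgebra_def)
  \<comment> \<open>A sum of subalgebras is not a subalgebra in general, but a submodule is all that
    \<open>span_monomials\<close> asks for.\<close>
  have sum: "submodule (Y1 <+>\<^bsub>DTL n\<^esub> Y2) laurent_ring (DTL n)"
    using module.submodule_set_add[OF module_DTL] Y1(2) Y2(2) by blast
  have "Y1 <+>\<^bsub>DTL n\<^esub> Y2 = carrier (DTL n)"
  proof (rule span_monomials[OF sum])
    interpret ring "DTL n" by (rule ring_DTL)
    fix w assume w: "set w \<subseteq> {..<n}"
    let ?w = "dtl_class n (monomial w)"
    have w': "?w \<in> carrier (DTL n)"
      using w by (simp add: dtl_class_closed monomial_closed)
    show "?w \<in> Y1 <+>\<^bsub>DTL n\<^esub> Y2"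
    proof (cases "0 \<in> set w")
      case True
      have "dtl_class n (monomial (hat_word i)) \<in> Y2" if "i < n" for i
        using that subalgebra_generated_superset[of ?h laurent_ring "DTL n"] assms
        by (auto simp: Y2_def dtl_e_hat_eq[symmetric])
      then have "dtl_class n (monomial (concat (map hat_word w))) \<in> Y2"
        using w by (intro subring_words[OF Y2(1)]) (auto simp: hat_word_letters)
      then have "?w \<in> Y2"
        using submodule_proportional[OF Y2(2) proportional_hat[OF w True]] by blast
      moreover have "\<zero>\<^bsub>DTL n\<^esub> \<in> Y1"
        by (rule subringE(2)[OF Y1(1)])
      ultimately show ?thesis
        using w' by (force simp: set_add_def')
    next
      case False
      have "dtl_class n (monomial [i]) \<in> Y1" if "i < n" "i \<noteq> 0" for i
        using that subalgebra_generated_superset[of ?e laurent_ring "DTL n"]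
        by (auto simp: Y1_def e[symmetric])
      \<comment> \<open>Any word is the concatenation of its one-letter words.\<close>
      then have "dtl_class n (monomial (concat (map (\<lambda>i. [i]) w))) \<in> Y1"
        using w False by (intro subring_words[OF Y1(1)]) (force, auto)
      then have "?w \<in> Y1"
        by simp
      moreover have "\<zero>\<^bsub>DTL n\<^esub> \<in> Y2"
        by (rule subringE(2)[OF Y2(1)])
      ultimately show ?thesis
        using w' by (force simp: set_add_def')
    qed
  qed
  then show "carrier (DTL n) = subalgebra_generated laurent_ring (DTL n) ?e
      <+>\<^bsub>DTL n\<^esub> subalgebra_generated laurent_ring (DTL n) ?h"
    by (simp add: Y1_def Y2_def)
next
  define N S0 where "N = catalan n + catalan (n + 1) - 1"
    and "S0 = (\<lambda>w. dtl_class n (monomial w)) ` normal_words n"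
  have S0: "finite S0" "card S0 \<le> N" "S0 \<subseteq> carrier (DTL n)"
  proof -
    show "finite S0"
      by (simp add: S0_def finite_normal_words)
    show "card S0 \<le> N"
      unfolding S0_def N_def
      by (rule order_trans[OF card_image_le[OF finite_normal_words] card_normal_words[OF assms]])
    show "S0 \<subseteq> carrier (DTL n)"
      unfolding S0_def by (intro image_subsetI dtl_class_closed monomial_closed normal_words_letters)
  qed
  \<comment> \<open>The normal words may coincide in the algebra, so their classes are padded to the required
    number of elements.\<close>
  obtain T where T: "finite T" "card T = N - card S0" "T \<subseteq> carrier (DTL n) - S0"
    using infinite_arbitrarily_large[of "carrier (DTL n) - S0" "N - card S0"] infinite_DTL S0(1) by auto
  define S where "S = S0 \<union> T"
  have "S0 \<inter> T = {}"
    using T(3) by blast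
  then have S: "S \<subseteq> carrier (DTL n)" "finite S" "card S = N"
    using S0 T by (auto simp: S_def card_Un_disjoint)
  moreover have "module_span laurent_ring (DTL n) S = carrier (DTL n)"
    unfolding module_span_def
  proof (rule hull_unique[OF S(1)])
    show "submodule (carrier (DTL n)) laurent_ring (DTL n)"
      by (rule module.carrier_is_submodule[OF module_DTL])
    fix H assume H: "S \<subseteq> H" "submodule H laurent_ring (DTL n)"
    \<comment> \<open>\<open>H\<close> contains the normal words and is closed under powers of
      \<open>\<delta>\<close>, hence contains every word.\<close>
    have "dtl_class n (monomial w) \<in> H" if w: "set w \<subseteq> {..<n}" for w
      using proportional_normal_word[OF w] submodule_proportional[OF H(2)] H(1) by (auto simp: S_def S0_def)
    then show "carrier (DTL n) \<subseteq> H"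
      using span_monomials[OF H(2)] by blast
  qed
  ultimately show "\<exists>S. S \<subseteq> carrier (DTL n) \<and> finite S \<and>
      card S = catalan n + catalan (n + 1) - 1 \<and>
      module_span laurent_ring (DTL n) S = carrier (DTL n)"
    unfolding N_def by blast
qed

end
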